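(* Let $V$ be a real topological vector space and let $q : V \to \mathbb{R}$ be a weak Minkowski norm that is continuous with respect to the topology of $V$. Let $P := \{ p \in V^* \mid \forall x \in V,\ \langle p, x\rangle \leq q(x) \}$. A function $f : V \to \mathbb{R}$ is positively homogeneous and nonexpansive with respect to $q$ if, and only if, $$f(x) = \min_{y \in V} \; \max_{p \in P_y} \; \langle p, x\rangle \quad \text{for all } x \in V ,$$ where $P_y := \{ p \in P \mid \langle p, y\rangle \leq f(y) \}$. Moreover, the value of the latter minimax expression does not change if the maximum is restricted to the points $p \in \overline{\operatorname{ext} P_y}$.
   Context: $V$ is a real topological vector space (not assumed Hausdorff or locally convex). $V^*$ denotes the space of all linear forms on $V$ (algebraic dual), and $\langle\cdot,\cdot\rangle$ is the duality product. A function $g : V \to \mathbb{R}$ is positively homogeneous if $g(\lambda x) = \lambda g(x)$ for all $\lambda \geq 0$, $x \in V$. A weak Minkowski norm on $V$ is a function $q : V \to \mathbb{R}$ that is convex and positively homogeneous (it need not be symmetric nor nonnegative). A function $f : V \to \mathbb{R}$ is nonexpansive with respect to $q$ if $f(x) - f(y) \leq q(x-y)$ for all $x,y \in V$. $\operatorname{ext} P_y$ is the set of extreme points of $P_y$, and $\overline{\operatorname{ext} P_y}$ its closure in the weak* topology (the topology of pointwise convergence on $V$). Writing $\min$ and $\max$ means that the extrema are attained. *)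

theory Defs
  imports "HOL-Analysis.Analysis" "HOL-Library.Function_Algebras"
begin

text \<open>Real topological vector spaces; neither Hausdorff nor locally convex.\<close>

class real_topological_vector = real_vector + topological_ab_group_add +
  assumes tendsto_scaleR_Pair:
    "LIM x (nhds a \<times>\<^sub>F nhds b). fst x *\<^sub>R snd x :> nhds (a *\<^sub>R b)"

text \<open>
  Pointwise scalar multiplication makes the space of all functions \<open>V \<Rightarrow> \<real>\<close> a real
  vector space, so that the library notion of extreme point applies to sets of linear
  forms, represented as plain functions.
\<close>

instantiation "fun" :: (type, real_vector) real_vector
begin

definition scaleR_fun :: "real \<Rightarrow> ('a \<Rightarrow> 'b) \<Rightarrow> 'a \<Rightarrow> 'b" where
  "scaleR_fun c f = (\<lambda>x. c *\<^sub>R f x)"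

instance
  by standard (simp_all add: scaleR_fun_def fun_eq_iff scaleR_add_right scaleR_add_left)

end

lemma scaleR_fun_apply [simp]: "(c *\<^sub>R f) x = c *\<^sub>R f x"
  by (simp add: scaleR_fun_def)

definition algebraic_dual :: "('a::real_vector \<Rightarrow> real) set" where
  "algebraic_dual = {p. linear p}"

text \<open>
  The topology of pointwise convergence on the algebraic dual; its underlying set is the
  dual, not the whole type.
\<close>

definition weak_star_topology :: "('a::real_vector \<Rightarrow> real) topology" where
  "weak_star_topology =
     subtopology (product_topology (\<lambda>_. euclideanreal) UNIV) algebraic_dual"

definition positively_homogeneous :: "('a::real_vector \<Rightarrow> real) \<Rightarrow> bool" where
  "positively_homogeneous g \<longleftrightarrow> (\<forall>c\<ge>0. \<forall>x. g (c *\<^sub>R x) = c * g x)"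

definition weak_Minkowski_norm :: "('a::real_vector \<Rightarrow> real) \<Rightarrow> bool" where
  "weak_Minkowski_norm q \<longleftrightarrow> convex_on UNIV q \<and> positively_homogeneous q"

definition nonexpansive :: "('a::real_vector \<Rightarrow> real) \<Rightarrow> ('a \<Rightarrow> real) \<Rightarrow> bool" where
  "nonexpansive q f \<longleftrightarrow> (\<forall>x y. f x - f y \<le> q (x - y))"

definition dominated_forms :: "('a::real_vector \<Rightarrow> real) \<Rightarrow> ('a \<Rightarrow> real) set" where
  "dominated_forms q = {p \<in> algebraic_dual. \<forall>x. p x \<le> q x}"

definition dominated_forms_at ::
  "('a::real_vector \<Rightarrow> real) \<Rightarrow> ('a \<Rightarrow> real) \<Rightarrow> 'a \<Rightarrow> ('a \<Rightarrow> real) set" where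
  "dominated_forms_at q f y = {p \<in> dominated_forms q. p y \<le> f y}"

definition is_maximum :: "real set \<Rightarrow> real \<Rightarrow> bool" where
  "is_maximum S m \<longleftrightarrow> m \<in> S \<and> (\<forall>s\<in>S. s \<le> m)"

definition is_minimum :: "real set \<Rightarrow> real \<Rightarrow> bool" where
  "is_minimum S m \<longleftrightarrow> m \<in> S \<and> (\<forall>s\<in>S. m \<le> s)"

text \<open>
  \<open>v = min\<^sub>y max {p x | p \<in> A y}\<close>, as a relation: the inner maximum must be attained
  for every \<open>y\<close> (in particular every \<open>A y\<close> is nonempty), and the outer minimum must be
  attained as well.
\<close>

definition is_minimax :: "('b \<Rightarrow> ('a \<Rightarrow> real) set) \<Rightarrow> 'a \<Rightarrow> real \<Rightarrow> bool" where
  "is_minimax A x v \<longleftrightarrow>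
     (\<exists>M. (\<forall>y. is_maximum ((\<lambda>p. p x) ` A y) (M y)) \<and> is_minimum (range M) v)"

end

theory Submission
  imports Defs
begin

text \<open>
  The representation rests on two facts about the weak* compact convex sets
  \<open>P\<^sub>y = {p \<in> P. p y \<le> f y}\<close>.

  First, a Hahn--Banach argument in a form adapted to two points: if \<open>f\<close> is positively
  homogeneous and nonexpansive, then for all \<open>x\<close> and \<open>y\<close> some linear \<open>p \<le> q\<close> satisfies both
  \<open>p y \<le> f y\<close> and \<open>p x \<ge> f x\<close>.  Nonexpansiveness, applied to \<open>t x\<close> and \<open>y\<close>, is precisely the
  compatibility condition under which \<open>q\<close> can be decreased to a smaller sublinear function
  encoding the two inequalities, and any linear form below that function will do.  Hence
  \<open>max {p x | p \<in> P\<^sub>y} \<ge> f x\<close> for every \<open>y\<close>; for \<open>y = x\<close> the definition of \<open>P\<^sub>x\<close> gives the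
  reverse inequality, so the minimum over \<open>y\<close> is \<open>f x\<close> and is attained at \<open>y = x\<close>.
  Conversely, for fixed \<open>y\<close> the function \<open>x \<mapsto> max {p x | p \<in> P\<^sub>y}\<close> is positively homogeneous
  and nonexpansive, and both properties pass to an attained pointwise minimum.

  Secondly, an evaluation \<open>p \<mapsto> p x\<close> attains its maximum over a nonempty compact convex set
  of functions at an extreme point (Bauer's maximum principle).  As \<open>P\<^sub>y\<close> is weak* closed,
  the closure of its extreme points lies between the extreme points and \<open>P\<^sub>y\<close>, so the inner
  maxima agree for every \<open>y\<close>.  This holds for an arbitrary function \<open>f\<close>: if some \<open>P\<^sub>y\<close> is
  empty, neither minimax expression has a value.
\<close>

section \<open>Sublinear functions\<close>

lemma weak_Minkowski_norm_iff_subadditive: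
  "weak_Minkowski_norm q \<longleftrightarrow> (\<forall>x y. q (x + y) \<le> q x + q y) \<and> positively_homogeneous q"
proof -
  have "q (x + y) \<le> q x + q y" if "convex_on UNIV q" and ph: "positively_homogeneous q" for x y
  proof -
    have "q ((1 - 1/2) *\<^sub>R (2 *\<^sub>R x) + (1/2) *\<^sub>R (2 *\<^sub>R y))
            \<le> (1 - 1/2) * q (2 *\<^sub>R x) + (1/2) * q (2 *\<^sub>R y)"
      by (rule convex_onD[OF that(1)]) auto
    moreover have "q (2 *\<^sub>R z) = 2 * q z" for z
      using ph by (simp add: positively_homogeneous_def)
    ultimately show ?thesis by simp
  qed
  moreover have "convex_on UNIV q"
    if sub: "\<forall>x y. q (x + y) \<le> q x + q y" and ph: "positively_homogeneous q"
  proof (rule convex_onI)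
    fix t :: real and x y :: 'a
    assume "0 < t" "t < 1"
    then show "q ((1 - t) *\<^sub>R x + t *\<^sub>R y) \<le> (1 - t) * q x + t * q y"
      using sub[rule_format, of "(1 - t) *\<^sub>R x" "t *\<^sub>R y"] ph
      by (simp add: positively_homogeneous_def)
  qed simp
  ultimately show ?thesis
    unfolding weak_Minkowski_norm_def by blast
qed

lemma weak_Minkowski_norm_add: "weak_Minkowski_norm q \<Longrightarrow> q (x + y) \<le> q x + q y"
  by (simp add: weak_Minkowski_norm_iff_subadditive)

lemma positively_homogeneousD: "positively_homogeneous g \<Longrightarrow> 0 \<le> c \<Longrightarrow> g (c *\<^sub>R x) = c * g x"
  by (simp add: positively_homogeneous_def)

lemma positively_homogeneous_zero: "positively_homogeneous g \<Longrightarrow> g 0 = 0"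
  using positively_homogeneousD[of g 0 0] by simp

lemma weak_Minkowski_norm_scale: "weak_Minkowski_norm q \<Longrightarrow> 0 \<le> c \<Longrightarrow> q (c *\<^sub>R x) = c * q x"
  by (simp add: weak_Minkowski_norm_def positively_homogeneousD)

lemma weak_Minkowski_norm_zero: "weak_Minkowski_norm q \<Longrightarrow> q 0 = 0"
  by (simp add: weak_Minkowski_norm_def positively_homogeneous_zero)

lemma weak_Minkowski_norm_minus: "weak_Minkowski_norm q \<Longrightarrow> - q (- x) \<le> q x"
  using weak_Minkowski_norm_add[of q x "- x"] weak_Minkowski_norm_zero[of q] by simp

text \<open>
  One inequality suffices for positive homogeneity: replacing \<open>c\<close> by its inverse yields the
  other one, and \<open>c = 2\<close> together with \<open>c = 1/2\<close> forces the value at the origin to vanish.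
\<close>

lemma positively_homogeneousI_le:
  assumes le: "\<And>c x. 0 < c \<Longrightarrow> g (c *\<^sub>R x) \<le> c * g x"
  shows "positively_homogeneous g"
  unfolding positively_homogeneous_def
proof (intro allI impI)
  fix c :: real and x :: 'a
  assume "0 \<le> c"
  have "g 0 = 0"
    using le[of 2 0] le[of "1/2" 0] by simp
  show "g (c *\<^sub>R x) = c * g x"
  proof (cases "c = 0")
    case True
    then show ?thesis using \<open>g 0 = 0\<close> by simp
  next
    case False
    with \<open>0 \<le> c\<close> have "0 < c" by simp
    then have "g x \<le> inverse c * g (c *\<^sub>R x)"
      using le[of "inverse c" "c *\<^sub>R x"] by simp
    then have "c * g x \<le> g (c *\<^sub>R x)"
      using \<open>0 < c\<close> by (simp add: field_simps)
    with le[OF \<open>0 < c\<close>] show ?thesis by (simp add: antisym)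
  qed
qed

text \<open>
  The members of the family need not be sublinear themselves; it is enough that the family
  as a whole absorbs sums and dilations.  Both chains of sublinear functions and the
  translates used to build one smaller sublinear function are of this kind.
\<close>

lemma weak_Minkowski_norm_INF:
  fixes g :: "'i \<Rightarrow> 'a::real_vector \<Rightarrow> real"
  assumes ne: "I \<noteq> {}"
    and bdd: "\<And>x. bdd_below ((\<lambda>i. g i x) ` I)"
    and add: "\<And>i j x y. i \<in> I \<Longrightarrow> j \<in> I \<Longrightarrow> \<exists>k\<in>I. g k (x + y) \<le> g i x + g j y"
    and scale: "\<And>i c x. i \<in> I \<Longrightarrow> 0 < c \<Longrightarrow> \<exists>k\<in>I. g k (c *\<^sub>R x) \<le> c * g i x"
  shows "weak_Minkowski_norm (\<lambda>x. INF i\<in>I. g i x)"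
proof -
  define u where "u = (\<lambda>x. INF i\<in>I. g i x)"
  have lower: "u x \<le> g i x" if "i \<in> I" for i x
    unfolding u_def using bdd that by (rule cINF_lower)
  have greatest: "m \<le> u x" if "\<And>i. i \<in> I \<Longrightarrow> m \<le> g i x" for m x
    unfolding u_def using ne that by (rule cINF_greatest)
  have "u (x + y) \<le> u x + u y" for x y
  proof -
    have "u (x + y) - g j y \<le> u x" if "j \<in> I" for j
    proof (rule greatest)
      fix i assume "i \<in> I"
      with add[OF this \<open>j \<in> I\<close>, of x y] lower show "u (x + y) - g j y \<le> g i x"
        by (meson diff_le_eq order_trans)
    qed
    then have "u (x + y) - u x \<le> g j y" if "j \<in> I" for j
      using that by (simp add: algebra_simps)
    then have "u (x + y) - u x \<le> u y" by (rule greatest)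
    then show ?thesis by simp
  qed
  moreover have "positively_homogeneous u"
  proof (rule positively_homogeneousI_le)
    fix c :: real and x :: 'a
    assume "0 < c"
    have "u (c *\<^sub>R x) / c \<le> u x"
    proof (rule greatest)
      fix i assume "i \<in> I"
      with scale[OF this \<open>0 < c\<close>, of x] lower have "u (c *\<^sub>R x) \<le> c * g i x"
        by (meson order_trans)
      with \<open>0 < c\<close> show "u (c *\<^sub>R x) / c \<le> g i x"
        by (simp add: field_simps)
    qed
    with \<open>0 < c\<close> show "u (c *\<^sub>R x) \<le> c * u x"
      by (simp add: field_simps)
  qed
  ultimately show ?thesis
    unfolding weak_Minkowski_norm_iff_subadditive u_def by blast
qed

text \<open>
  The basic step of the Hahn--Banach argument.  A sublinear \<open>s \<le> q\<close> with \<open>s (- x) \<le> - a\<close>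
  satisfies \<open>s z \<le> s (z + t x) + t s (- x) \<le> q (z + t x) - t a\<close> for all \<open>t \<ge> 0\<close>, so the
  infimum of the right-hand side over \<open>t\<close> is the largest possible choice; the hypothesis on
  \<open>a\<close> is what keeps it finite.  The last conclusion says that nothing smaller than this
  infimum was chosen, which is what permits a second step starting from \<open>r\<close>.
\<close>

lemma weak_Minkowski_norm_decrease:
  assumes q: "weak_Minkowski_norm q" and a: "a \<le> q x"
  obtains r where "weak_Minkowski_norm r" and "r \<le> q" and "r (- x) \<le> - a"
    and "\<And>z m. (\<And>t. 0 \<le> t \<Longrightarrow> m \<le> q (z + t *\<^sub>R x) - t * a) \<Longrightarrow> m \<le> r z"
proof
  let ?g = "\<lambda>t z. q (z + t *\<^sub>R x) - t * a"
  let ?r = "\<lambda>z. INF t\<in>{0..}. ?g t z"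
  have "- q (- z) \<le> ?g t z" if "0 \<le> t" for t z
  proof -
    have "t * a \<le> t * q x"
      using a that by (rule mult_left_mono)
    also have "\<dots> = q ((z + t *\<^sub>R x) + (- z))"
      using weak_Minkowski_norm_scale[OF q that] by simp
    also have "\<dots> \<le> q (z + t *\<^sub>R x) + q (- z)"
      by (rule weak_Minkowski_norm_add[OF q])
    finally show ?thesis by simp
  qed
  then have bdd: "bdd_below ((\<lambda>t. ?g t z) ` {0..})" for z
    by (intro bdd_belowI[of _ "- q (- z)"]) auto
  show "weak_Minkowski_norm ?r"
  proof (rule weak_Minkowski_norm_INF)
    fix s t :: real and z w :: 'a
    assume "s \<in> {0..}" "t \<in> {0..}"
    moreover have "q (z + w + (s + t) *\<^sub>R x) \<le> q (z + s *\<^sub>R x) + q (w + t *\<^sub>R x)"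
      using weak_Minkowski_norm_add[OF q, of "z + s *\<^sub>R x" "w + t *\<^sub>R x"]
      by (simp add: algebra_simps)
    ultimately show "\<exists>k\<in>{0..}. ?g k (z + w) \<le> ?g s z + ?g t w"
      by (intro bexI[of _ "s + t"]) (auto simp: algebra_simps)
  next
    fix t c :: real and z :: 'a
    assume "t \<in> {0..}" "0 < c"
    moreover have "q (c *\<^sub>R z + (c * t) *\<^sub>R x) = c * q (z + t *\<^sub>R x)"
      using weak_Minkowski_norm_scale[OF q, of c "z + t *\<^sub>R x"] \<open>0 < c\<close>
      by (simp add: scaleR_add_right)
    ultimately show "\<exists>k\<in>{0..}. ?g k (c *\<^sub>R z) \<le> c * ?g t z"
      by (intro bexI[of _ "c * t"]) (auto simp: algebra_simps)
  qed (use bdd in auto)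
  have lower: "?r z \<le> ?g t z" if "0 \<le> t" for t z
    using bdd that by (intro cINF_lower) auto
  show "?r \<le> q"
    using lower[of 0] by (simp add: le_fun_def)
  show "?r (- x) \<le> - a"
    using lower[of 1 "- x"] weak_Minkowski_norm_zero[OF q] by simp
  show "m \<le> ?r z" if "\<And>t. 0 \<le> t \<Longrightarrow> m \<le> ?g t z" for z m
    using that by (intro cINF_greatest) auto
qed

section \<open>Linear forms below a sublinear function\<close>

text \<open>
  Zorn's lemma applies because every sublinear \<open>r \<le> q\<close> satisfies
  \<open>- q (- x) \<le> - r (- x) \<le> r x\<close>, so that the pointwise infimum of a chain is finite.
\<close>

lemma exists_minimal_weak_Minkowski_norm:
  assumes q: "weak_Minkowski_norm q"
  obtains m where "weak_Minkowski_norm m" and "m \<le> q"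
    and "\<And>r. weak_Minkowski_norm r \<Longrightarrow> r \<le> m \<Longrightarrow> r = m"
proof -
  let ?A = "{r. weak_Minkowski_norm r \<and> r \<le> q}"
  have "\<exists>m\<in>?A. \<forall>r\<in>?A. r \<le> m \<longrightarrow> r = m"
  proof (rule predicate_Zorn)
    show "partial_order_on ?A (relation_of (\<lambda>r s. s \<le> r) ?A)"
      by (rule partial_order_on_relation_ofI) auto
  next
    fix C assume C: "C \<in> Chains (relation_of (\<lambda>r s. s \<le> r) ?A)"
    then have sub: "C \<subseteq> ?A" by (rule Chains_relation_of)
    have total: "r \<le> s \<or> s \<le> r" if "r \<in> C" "s \<in> C" for r s
      using C that unfolding Chains_def relation_of_def by auto
    show "\<exists>u\<in>?A. \<forall>r\<in>C. u \<le> r"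
    proof (cases "C = {}")
      case True
      then show ?thesis using q by auto
    next
      case False
      let ?u = "\<lambda>x. INF r\<in>C. r x"
      have "- q (- x) \<le> r x" if "r \<in> C" for r x
      proof -
        have "weak_Minkowski_norm r" "r (- x) \<le> q (- x)"
          using sub that by (auto simp: le_fun_def)
        then show ?thesis using weak_Minkowski_norm_minus[of r x] by linarith
      qed
      then have bdd: "bdd_below ((\<lambda>r. r x) ` C)" for x
        by (intro bdd_belowI[of _ "- q (- x)"]) auto
      have u: "weak_Minkowski_norm ?u"
      proof (rule weak_Minkowski_norm_INF)
        fix r s x y assume rs: "r \<in> C" "s \<in> C"
        then have "r (x + y) \<le> r x + r y" "s (x + y) \<le> s x + s y"
          using sub by (auto intro: weak_Minkowski_norm_add)
        moreover have "r y \<le> s y \<or> s x \<le> r x"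
          using total[OF rs] by (auto simp: le_fun_def)
        ultimately have "r (x + y) \<le> r x + s y \<or> s (x + y) \<le> r x + s y"
          by linarith
        then show "\<exists>t\<in>C. t (x + y) \<le> r x + s y"
          using rs by blast
      next
        fix r x and c :: real assume "r \<in> C" "0 < c"
        then show "\<exists>t\<in>C. t (c *\<^sub>R x) \<le> c * r x"
          using sub weak_Minkowski_norm_scale[of r c x] by (intro bexI[of _ r]) auto
      qed (use False bdd in auto)
      have lower: "?u \<le> r" if "r \<in> C" for r
        unfolding le_fun_def using bdd that by (auto intro: cINF_lower)
      obtain r where "r \<in> C" using False by blast
      then have "?u \<le> q"
        using lower[of r] sub by (auto intro: order_trans)
      with u lower show ?thesis by blast
    qed
  qed
  then show ?thesis
    using that by (metis (mono_tags, lifting) mem_Collect_eq order_trans)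
qed

text \<open>
  A minimal sublinear function cannot be decreased, so its own value at \<open>x\<close> is a legitimate
  choice of \<open>a\<close> in the basic step; this makes the function odd, hence linear.
\<close>

theorem exists_linear_le_weak_Minkowski_norm:
  assumes "weak_Minkowski_norm q"
  obtains p where "linear p" and "p \<le> q"
proof -
  obtain m where m: "weak_Minkowski_norm m" "m \<le> q"
    and minimal: "\<And>r. weak_Minkowski_norm r \<Longrightarrow> r \<le> m \<Longrightarrow> r = m"
    using exists_minimal_weak_Minkowski_norm[OF assms] by blast
  have le: "m (- x) \<le> - m x" for x
    using weak_Minkowski_norm_decrease[OF m(1) order_refl, of x] minimal by metis
  have odd: "m (- x) = - m x" for x
    using le[of x] weak_Minkowski_norm_minus[OF m(1), of x] by linarith
  have "m (x + y) = m x + m y" for x y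
    using weak_Minkowski_norm_add[OF m(1), of x y] weak_Minkowski_norm_add[OF m(1), of "- x" "- y"]
      odd[of "x + y"] odd[of x] odd[of y]
    by (simp add: algebra_simps)
  moreover have "m (c *\<^sub>R x) = c * m x" for c x
    using weak_Minkowski_norm_scale[OF m(1), of c x] weak_Minkowski_norm_scale[OF m(1), of "- c" x]
      odd[of "c *\<^sub>R x"]
    by (cases "0 \<le> c") auto
  ultimately have "linear m"
    by (intro linearI) auto
  with m(2) show ?thesis using that by blast
qed

text \<open>
  Decrease \<open>q\<close> first so as to impose \<open>p x \<ge> a\<close>, and then once more to impose \<open>p y \<le> b\<close>.
  The hypothesis is the condition that the second step needs.
\<close>

lemma exists_linear_between:
  assumes q: "weak_Minkowski_norm q"
    and a: "a \<le> q x"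
    and ab: "\<And>t. 0 \<le> t \<Longrightarrow> t * a - b \<le> q (t *\<^sub>R x - y)"
  obtains p where "linear p" and "p \<le> q" and "a \<le> p x" and "p y \<le> b"
proof -
  obtain r where r: "weak_Minkowski_norm r" "r \<le> q" "r (- x) \<le> - a"
    and largest: "\<And>z m. (\<And>t. 0 \<le> t \<Longrightarrow> m \<le> q (z + t *\<^sub>R x) - t * a) \<Longrightarrow> m \<le> r z"
    using weak_Minkowski_norm_decrease[OF q a] by blast
  have "- b \<le> r (- y)"
  proof (rule largest)
    fix t :: real assume "0 \<le> t"
    then show "- b \<le> q (- y + t *\<^sub>R x) - t * a"
      using ab[of t] by (simp add: algebra_simps)
  qed
  then obtain s where s: "weak_Minkowski_norm s" "s \<le> r" "s y \<le> b"
    using weak_Minkowski_norm_decrease[OF r(1), of "- b" "- y"] by (metis minus_minus)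
  obtain p where p: "linear p" "p \<le> s"
    using exists_linear_le_weak_Minkowski_norm[OF s(1)] by blast
  have "p (- x) \<le> - a" "p y \<le> b"
    using p(2) s(2,3) r(3) by (meson le_funD order_trans)+
  moreover have "p \<le> q"
    using p(2) s(2) r(2) by (meson order_trans)
  ultimately show ?thesis
    using that[OF p(1)] linear_neg[OF p(1), of x] by simp
qed

section \<open>Maxima at extreme points\<close>

lemma compact_imp_closed_real_fun:
  fixes C :: "('a \<Rightarrow> real) set"
  assumes "compact C"
  shows "closed C"
proof -
  have "Hausdorff_space (euclidean :: ('a \<Rightarrow> real) topology)"
    by (simp add: Hausdorff_space_product_topology flip: euclidean_product_topology)
  then show ?thesis
    using assms compactin_imp_closedin[of euclidean C] by simp
qed

definition max_face :: "('a \<Rightarrow> real) set \<Rightarrow> 'a \<Rightarrow> ('a \<Rightarrow> real) set" where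
  "max_face C x = {p \<in> C. \<forall>p'\<in>C. p' x \<le> p x}"

lemma max_face_face_of:
  assumes "convex C"
  shows "max_face C x face_of C"
proof -
  have eq: "p x = p' x" if "p \<in> max_face C x" "p' \<in> max_face C x" for p p'
    using that by (simp add: max_face_def order_antisym)
  have left: "a \<in> max_face C x"
    if a: "a \<in> C" and b: "b \<in> C" and p: "p \<in> max_face C x" and seg: "p \<in> open_segment a b" for a b p
  proof -
    obtain u where u: "0 < u" "u < 1" "p = (1 - u) *\<^sub>R a + u *\<^sub>R b"
      using seg by (auto simp: in_segment)
    have "b x \<le> p x"
      using p b by (simp add: max_face_def)
    then have "u * b x \<le> u * p x"
      using u(1) by simp
    moreover have "p x = (1 - u) * a x + u * b x"
      using u(3) by simp
    moreover have "(1 - u) * p x = p x - u * p x"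
      by (simp add: left_diff_distrib)
    ultimately have "(1 - u) * p x \<le> (1 - u) * a x"
      by linarith
    then have "p x \<le> a x"
      using u(2) by simp
    with p a show ?thesis
      unfolding max_face_def by (blast intro: order_trans)
  qed
  have "convex (max_face C x)"
  proof (rule convexI)
    fix p p' and u v :: real
    assume p: "p \<in> max_face C x" "p' \<in> max_face C x" and uv: "0 \<le> u" "0 \<le> v" "u + v = 1"
    have "u *\<^sub>R p + v *\<^sub>R p' \<in> C"
      using assms p uv by (auto simp: max_face_def convex_def)
    moreover have "(u *\<^sub>R p + v *\<^sub>R p') x = p x"
      using eq[OF p] uv by (simp flip: distrib_right)
    ultimately show "u *\<^sub>R p + v *\<^sub>R p' \<in> max_face C x"
      using p(1) by (simp add: max_face_def)
  qed
  moreover have "max_face C x \<subseteq> C"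
    by (auto simp: max_face_def)
  ultimately show ?thesis
    unfolding face_of_def using left open_segment_commute by metis
qed

lemma continuous_on_eval: "continuous_on S (\<lambda>p::'a \<Rightarrow> real. p x)"
  by (rule continuous_on_subset[OF continuous_on_product_coordinates subset_UNIV])

lemma max_face_nonempty:
  assumes "compact C" "C \<noteq> {}"
  shows "max_face C x \<noteq> {}"
  using continuous_attains_sup[OF assms continuous_on_eval[of C x]] by (auto simp: max_face_def)

lemma closed_max_face:
  assumes "closed C"
  shows "closed (max_face C x)"
proof -
  have "max_face C x = C \<inter> (\<Inter>p'\<in>C. {p. p' x \<le> p x})"
    by (auto simp: max_face_def)
  moreover have "closed {p::'a \<Rightarrow> real. c \<le> p x}" for c
    by (intro closed_Collect_le continuous_on_const continuous_on_eval)
  ultimately show ?thesis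
    using assms by (simp add: closed_Int closed_INT)
qed

text \<open>
  Bauer's maximum principle for evaluations.  Among the closed nonempty faces contained in
  the face of maximizers, compactness yields a minimal one.  It is a single point: otherwise
  two of its elements differ at some \<open>y\<close>, and maximizing \<open>p y\<close> cuts out a smaller face.
\<close>

theorem eval_max_at_extreme_point:
  fixes C :: "('a \<Rightarrow> real) set"
  assumes C: "compact C" "convex C" "C \<noteq> {}"
  obtains p where "p extreme_point_of C" and "\<And>p'. p' \<in> C \<Longrightarrow> p' x \<le> p x"
proof -
  define A where "A = {F. F face_of C \<and> closed F \<and> F \<noteq> {} \<and> F \<subseteq> max_face C x}"
  have "max_face C x \<in> A"
    using C by (simp add: A_def max_face_face_of max_face_nonempty closed_max_face
        compact_imp_closed_real_fun)
  have "\<exists>F\<in>A. \<forall>G\<in>A. G \<subseteq> F \<longrightarrow> G = F"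
  proof (rule predicate_Zorn)
    show "partial_order_on A (relation_of (\<lambda>F G. G \<subseteq> F) A)"
      by (rule partial_order_on_relation_ofI) auto
  next
    fix \<C> assume chain: "\<C> \<in> Chains (relation_of (\<lambda>F G. G \<subseteq> F) A)"
    then have sub: "\<C> \<subseteq> A" by (rule Chains_relation_of)
    with chain have ch: "subset.chain A \<C>"
      unfolding subset_chain_def Chains_def relation_of_def by auto
    show "\<exists>U\<in>A. \<forall>F\<in>\<C>. U \<subseteq> F"
    proof (cases "\<C> = {}")
      case True
      then show ?thesis using \<open>max_face C x \<in> A\<close> by auto
    next
      case False
      have "C \<inter> \<Inter>\<C> \<noteq> {}"
      proof (rule compact_imp_fip[OF C(1)])
        fix \<F> assume fin: "finite \<F>" "\<F> \<subseteq> \<C>"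
        show "C \<inter> \<Inter>\<F> \<noteq> {}"
        proof (cases "\<F> = {}")
          case True
          then show ?thesis using C(3) by simp
        next
          case False
          have "\<forall>X\<in>\<F>. \<forall>Y\<in>\<F>. X \<subseteq> Y \<or> Y \<subseteq> X"
            using ch fin(2) unfolding subset_chain_def by (meson subsetD)
          then have "subset.chain A \<F>"
            using order_trans[OF fin(2) sub] unfolding subset_chain_def by (rule conjI[rotated])
          then have "\<Inter>\<F> \<in> A"
            using Inter_in_chain[OF fin(1) False] fin(2) sub by (meson subsetD)
          then have "\<Inter>\<F> \<subseteq> C" "\<Inter>\<F> \<noteq> {}"
            using face_of_imp_subset unfolding A_def by auto
          then show ?thesis
            by (simp add: inf.absorb2)
        qed
      qed (use sub in \<open>auto simp: A_def\<close>)
      then have "\<Inter>\<C> \<noteq> {}" by auto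
      moreover have "\<Inter>\<C> face_of C"
        using False sub by (intro face_of_Inter) (auto simp: A_def)
      moreover have "closed (\<Inter>\<C>)"
        using sub by (intro closed_Inter) (auto simp: A_def)
      moreover have "\<Inter>\<C> \<subseteq> max_face C x"
      proof -
        obtain F where "F \<in> \<C>" using False by blast
        then have "F \<subseteq> max_face C x" using sub by (auto simp: A_def)
        with \<open>F \<in> \<C>\<close> show ?thesis by (meson Inter_lower order_trans)
      qed
      ultimately have "\<Inter>\<C> \<in> A" by (simp add: A_def)
      then show ?thesis by (meson Inter_lower)
    qed
  qed
  then obtain F where "F \<in> A" and minimal: "\<And>G. G \<in> A \<Longrightarrow> G \<subseteq> F \<Longrightarrow> G = F"
    by meson
  then have F: "F face_of C" "closed F" "F \<noteq> {}" "F \<subseteq> max_face C x"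
    by (simp_all add: A_def)
  have "F \<subseteq> C" "convex F"
    using F(1) by (auto simp: face_of_def)
  have "compact F"
    using compact_Int_closed[OF C(1) F(2)] \<open>F \<subseteq> C\<close> by (simp add: inf.absorb2)
  have max_F: "max_face F y = F" for y
  proof (rule minimal)
    have "max_face F y face_of C"
      using max_face_face_of[OF \<open>convex F\<close>] F(1) by (rule face_of_trans)
    moreover have "max_face F y \<subseteq> max_face C x"
      using F(4) by (auto simp: max_face_def)
    ultimately show "max_face F y \<in> A"
      using max_face_nonempty[OF \<open>compact F\<close> F(3)] closed_max_face[OF F(2)]
      by (simp add: A_def)
  qed (auto simp: max_face_def)
  obtain p where "p \<in> F" using F(3) by blast
  have "p' = p" if "p' \<in> F" for p'
  proof
    fix y
    have "p \<in> max_face F y" "p' \<in> max_face F y"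
      using \<open>p \<in> F\<close> that max_F by auto
    then show "p' y = p y"
      by (auto simp: max_face_def intro: antisym)
  qed
  with \<open>p \<in> F\<close> have "F = {p}" by blast
  then have "p extreme_point_of C"
    using F(1) face_of_singleton by metis
  moreover have "p \<in> max_face C x"
    using F(4) \<open>p \<in> F\<close> by blast
  ultimately show ?thesis
    using that by (auto simp: max_face_def)
qed

section \<open>The sets of dominated forms\<close>

lemma closed_linear_forms: "closed {p::'a::real_vector \<Rightarrow> real. linear p}"
proof -
  have "{p::'a \<Rightarrow> real. linear p} =
      (\<Inter>x y. {p. p (x + y) = p x + p y}) \<inter> (\<Inter>c x. {p. p (c *\<^sub>R x) = c * p x})"
    by (auto simp: linear_iff)
  moreover have "closed {p::'a \<Rightarrow> real. p (x + y) = p x + p y}" for x y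
    by (intro closed_Collect_eq continuous_on_add continuous_on_eval)
  moreover have "closed {p::'a \<Rightarrow> real. p (c *\<^sub>R x) = c * p x}" for c x
    by (intro closed_Collect_eq continuous_on_mult continuous_on_const continuous_on_eval)
  ultimately show ?thesis
    by (auto intro!: closed_Int closed_INT)
qed

lemma closed_dominated_forms_at: "closed (dominated_forms_at q f y)"
proof -
  have "dominated_forms_at q f y =
      {p. linear p} \<inter> (\<Inter>x. {p. p x \<le> q x}) \<inter> {p. p y \<le> f y}"
    by (auto simp: dominated_forms_at_def dominated_forms_def algebraic_dual_def)
  moreover have "closed {p::'a \<Rightarrow> real. p x \<le> c}" for x c
    by (intro closed_Collect_le continuous_on_const continuous_on_eval)
  ultimately show ?thesis
    by (auto intro!: closed_Int closed_INT closed_linear_forms)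
qed

text \<open>
  The Banach--Alaoglu argument: \<open>- q (- x) \<le> p x \<le> q x\<close> confines the forms to a product of
  compact intervals.
\<close>

lemma compact_dominated_forms_at: "compact (dominated_forms_at q f y)"
proof -
  let ?box = "PiE UNIV (\<lambda>x. {- q (- x)..q x})"
  have "compactin (product_topology (\<lambda>_. euclidean) UNIV) ?box"
    by (subst compactin_PiE) simp
  then have "compact ?box"
    by (simp add: euclidean_product_topology)
  moreover have "dominated_forms_at q f y \<subseteq> ?box"
  proof
    fix p assume "p \<in> dominated_forms_at q f y"
    then have p: "linear p" "\<And>x. p x \<le> q x"
      by (auto simp: dominated_forms_at_def dominated_forms_def algebraic_dual_def)
    have "- q (- x) \<le> p x" for x
      using p(2)[of "- x"] linear_neg[OF p(1), of x] by simp
    with p(2) show "p \<in> ?box" by auto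
  qed
  ultimately show ?thesis
    using compact_Int_closed[OF _ closed_dominated_forms_at] by (metis inf.absorb2)
qed

lemma convex_dominated_forms_at: "convex (dominated_forms_at q f y)"
proof (rule convexI)
  fix p p' and u v :: real
  assume p: "p \<in> dominated_forms_at q f y" "p' \<in> dominated_forms_at q f y"
    and uv: "0 \<le> u" "0 \<le> v" "u + v = 1"
  then have lin: "linear p" "linear p'"
    by (auto simp: dominated_forms_at_def dominated_forms_def algebraic_dual_def)
  have "linear (u *\<^sub>R p + v *\<^sub>R p')"
    by (intro linearI)
      (simp_all add: linear_add[OF lin(1)] linear_add[OF lin(2)] linear_scale[OF lin(1)]
        linear_scale[OF lin(2)] algebra_simps)
  moreover have "u * p x + v * p' x \<le> b" if "p x \<le> b" "p' x \<le> b" for x b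
    using convex_bound_le[OF that uv] .
  ultimately show "u *\<^sub>R p + v *\<^sub>R p' \<in> dominated_forms_at q f y"
    using p by (auto simp: dominated_forms_at_def dominated_forms_def algebraic_dual_def)
qed

section \<open>Restricting the maximum to extreme points\<close>

lemma closure_extreme_points_bounds:
  fixes q f :: "'a::real_vector \<Rightarrow> real" and y :: 'a
  defines "E \<equiv> {p. p extreme_point_of dominated_forms_at q f y}"
  shows "E \<subseteq> weak_star_topology closure_of E"
    and "weak_star_topology closure_of E \<subseteq> dominated_forms_at q f y"
proof -
  have E: "E \<subseteq> dominated_forms_at q f y"
    by (auto simp: E_def extreme_point_of_def)
  have dual: "dominated_forms_at q f y \<subseteq> algebraic_dual"
    by (auto simp: dominated_forms_at_def dominated_forms_def)
  have top: "weak_star_topology = subtopology euclidean (algebraic_dual :: ('a \<Rightarrow> real) set)"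
    by (simp add: weak_star_topology_def euclidean_product_topology)
  show "E \<subseteq> weak_star_topology closure_of E"
    using E dual by (intro closure_of_subset) (auto simp: top)
  have "closedin weak_star_topology (dominated_forms_at q f y)"
    unfolding top using dual closed_dominated_forms_at by (rule closed_subset)
  then show "weak_star_topology closure_of E \<subseteq> dominated_forms_at q f y"
    using E by (intro closure_of_minimal)
qed

lemma is_maximum_closure_extreme_points:
  "is_maximum ((\<lambda>p. p x) ` dominated_forms_at q f y) m \<longleftrightarrow>
   is_maximum ((\<lambda>p. p x) `
      (weak_star_topology closure_of {p. p extreme_point_of dominated_forms_at q f y})) m"
  (is "is_maximum (_ ` ?P) m \<longleftrightarrow> is_maximum (_ ` ?K) m")
proof (cases "?P = {}")
  case True
  then have "?K = {}"
    using closure_extreme_points_bounds(2)[of q f y] by simp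
  with True show ?thesis by simp
next
  case False
  then obtain p where p: "p extreme_point_of ?P" "\<And>p'. p' \<in> ?P \<Longrightarrow> p' x \<le> p x"
    using eval_max_at_extreme_point[OF compact_dominated_forms_at convex_dominated_forms_at]
    by blast
  have "p \<in> ?K"
    using closure_extreme_points_bounds(1)[of q f y] p(1) by blast
  moreover have "?K \<subseteq> ?P"
    by (rule closure_extreme_points_bounds(2))
  ultimately have "is_maximum ((\<lambda>p. p x) ` ?P) (p x)" "is_maximum ((\<lambda>p. p x) ` ?K) (p x)"
    using p(2) by (auto simp: is_maximum_def)
  moreover have "m = m'" if "is_maximum S m" "is_maximum S m'" for S m m'
    using that by (auto simp: is_maximum_def intro: antisym)
  ultimately show ?thesis by metis
qed

section \<open>The minimax representation\<close>

lemma minimax_of_nonexpansive: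
  assumes q: "weak_Minkowski_norm q"
    and hom: "positively_homogeneous f" and nonexp: "nonexpansive q f"
  shows "is_minimax (dominated_forms_at q f) x (f x)"
proof -
  have "f 0 = 0"
    using hom by (rule positively_homogeneous_zero)
  have witness: "\<exists>p\<in>dominated_forms_at q f y. f x \<le> p x" for y
  proof -
    have "f x \<le> q x"
      using nonexp[unfolded nonexpansive_def, rule_format, of x 0] \<open>f 0 = 0\<close> by simp
    moreover have "t * f x - f y \<le> q (t *\<^sub>R x - y)" if "0 \<le> t" for t
      using nonexp positively_homogeneousD[OF hom that, of x]
      unfolding nonexpansive_def by metis
    ultimately obtain p where "linear p" "p \<le> q" "f x \<le> p x" "p y \<le> f y"
      using exists_linear_between[OF q] by metis
    then show ?thesis
      by (auto simp: dominated_forms_at_def dominated_forms_def algebraic_dual_def le_fun_def)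
  qed
  have "\<exists>m. is_maximum ((\<lambda>p. p x) ` dominated_forms_at q f y) m" for y
  proof -
    have "dominated_forms_at q f y \<noteq> {}"
      using witness by blast
    then obtain p where "p \<in> max_face (dominated_forms_at q f y) x"
      using max_face_nonempty[OF compact_dominated_forms_at] by blast
    then show ?thesis
      by (auto simp: max_face_def is_maximum_def)
  qed
  then obtain M where M: "\<And>y. is_maximum ((\<lambda>p. p x) ` dominated_forms_at q f y) (M y)"
    by metis
  have lower: "f x \<le> M y" for y
    using witness[of y] M[of y] by (force simp: is_maximum_def)
  have "M x \<le> f x"
    using M[of x] by (auto simp: is_maximum_def dominated_forms_at_def)
  with lower have "M x = f x"
    by (simp add: antisym)
  with lower have "is_minimum (range M) (f x)"
    by (auto simp: is_minimum_def) (metis rangeI)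
  with M show ?thesis
    by (auto simp: is_minimax_def)
qed

text \<open>
  The two inequalities that an attained minimax provides: the value bounds each inner
  maximum from below, and some index \<open>y\<close> bounds all its forms by the value.
\<close>

lemma is_minimaxE:
  assumes "is_minimax A x v"
  obtains y where "\<And>p. p \<in> A y \<Longrightarrow> p x \<le> v" and "\<And>z. \<exists>p\<in>A z. v \<le> p x"
proof -
  obtain M where M: "\<And>y. is_maximum ((\<lambda>p. p x) ` A y) (M y)" and v: "is_minimum (range M) v"
    using assms by (auto simp: is_minimax_def)
  obtain y where "v = M y"
    using v by (auto simp: is_minimum_def)
  then have "p x \<le> v" if "p \<in> A y" for p
    using M[of y] that by (auto simp: is_maximum_def)
  moreover have "\<exists>p\<in>A z. v \<le> p x" for z
  proof -
    obtain p where "p \<in> A z" "M z = p x"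
      using M[of z] by (auto simp: is_maximum_def)
    moreover have "v \<le> M z"
      using v by (auto simp: is_minimum_def)
    ultimately show ?thesis by auto
  qed
  ultimately show ?thesis
    using that by blast
qed

text \<open>
  Take for \<open>z\<close> an index that attains the minimum at \<open>y\<close>, and for \<open>p\<close> a form in \<open>P\<^sub>z\<close> that is
  at least \<open>f x\<close> at \<open>x\<close>; then \<open>f x - f y \<le> p x - p y = p (x - y) \<le> q (x - y)\<close>.  Positive
  homogeneity follows in the same way, comparing \<open>x\<close> with \<open>c x\<close>.
\<close>

lemma nonexpansive_of_minimax:
  assumes minimax: "\<And>x. is_minimax (dominated_forms_at q f) x (f x)"
  shows "nonexpansive q f"
  unfolding nonexpansive_def
proof (intro allI)
  fix x y
  obtain z where z: "\<And>p. p \<in> dominated_forms_at q f z \<Longrightarrow> p y \<le> f y"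
    using is_minimaxE[OF minimax[of y]] by metis
  obtain p where p: "p \<in> dominated_forms_at q f z" "f x \<le> p x"
    using is_minimaxE[OF minimax[of x]] by metis
  have "linear p" "p (x - y) \<le> q (x - y)"
    using p(1) by (auto simp: dominated_forms_at_def dominated_forms_def algebraic_dual_def)
  then show "f x - f y \<le> q (x - y)"
    using p(2) z[OF p(1)] linear_diff[of p x y] by simp
qed

lemma positively_homogeneous_of_minimax:
  assumes minimax: "\<And>x. is_minimax (dominated_forms_at q f) x (f x)"
  shows "positively_homogeneous f"
proof (rule positively_homogeneousI_le)
  fix c :: real and x
  assume "0 < c"
  obtain z where z: "\<And>p. p \<in> dominated_forms_at q f z \<Longrightarrow> p x \<le> f x"
    using is_minimaxE[OF minimax[of x]] by metis
  obtain p where p: "p \<in> dominated_forms_at q f z" "f (c *\<^sub>R x) \<le> p (c *\<^sub>R x)"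
    using is_minimaxE[OF minimax[of "c *\<^sub>R x"]] by metis
  have "linear p"
    using p(1) by (auto simp: dominated_forms_at_def dominated_forms_def algebraic_dual_def)
  then have "p (c *\<^sub>R x) = c * p x"
    by (simp add: linear_scale)
  then show "f (c *\<^sub>R x) \<le> c * f x"
    using p(2) z[OF p(1)] mult_left_mono[of "p x" "f x" c] \<open>0 < c\<close> by linarith
qed

theorem theorem3p10:
  fixes q f :: "'a::real_topological_vector \<Rightarrow> real"
  assumes "weak_Minkowski_norm q"
    and "continuous_on UNIV q"
  shows "((positively_homogeneous f \<and> nonexpansive q f) \<longleftrightarrow>
            (\<forall>x. is_minimax (dominated_forms_at q f) x (f x)))
       \<and> (\<forall>x v. is_minimax (dominated_forms_at q f) x v \<longleftrightarrow>
            is_minimax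
              (\<lambda>y. weak_star_topology closure_of {p. p extreme_point_of dominated_forms_at q f y})
              x v)"
proof (intro conjI iffI allI)
  fix x
  assume "positively_homogeneous f \<and> nonexpansive q f"
  then show "is_minimax (dominated_forms_at q f) x (f x)"
    using minimax_of_nonexpansive[OF assms(1)] by blast
next
  assume "\<forall>x. is_minimax (dominated_forms_at q f) x (f x)"
  then show "positively_homogeneous f" "nonexpansive q f"
    using positively_homogeneous_of_minimax nonexpansive_of_minimax by blast+
qed (simp_all add: is_minimax_def is_maximum_closure_extreme_points)

end
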